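(* Let $\Bbbk$ be an algebraically closed field of characteristic $p>0$. Suppose $G$ is a finite group and $P$ a Sylow $p$-subgroup of $G$. If $V=V_{\mathrm{reg},G}^{\,n}$ is a free $G$-module over $\Bbbk$, where $V_{\mathrm{reg},G}=\Bbbk G$ is the regular representation, then $\epsilon(G,v)=|P|$ for any $v\in V^G\setminus\{0\}$.
   Context: $\Bbbk[V]\cong S(V^* )$ is the ring of polynomial functions on $V$, with $G$-action $(g\cdot f)(v)=f(g^{-1}v)$; $\Bbbk[V]^G_d$ is the set of homogeneous invariants of degree $d$ together with $0$. For $v\in V$, $\epsilon(G,v)=\inf\{d\in\mathbb{N}_{>0} : \text{there exists } f\in\Bbbk[V]^G_d\text{ with } f(v)\neq 0\}$, where the infimum of the empty set is $\infty$. *)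

theory Defs
  imports
    "HOL-Algebra.Algebra"
    "HOL-Computational_Algebra.Computational_Algebra"
    "HOL-Library.Extended_Nat"
    "HOL-Library.Function_Algebras"
begin

text \<open>
  The ground field is a type \<open>'k\<close>, vectors live in an ambient type \<open>'v\<close> with scalar
  multiplication \<open>scale\<close>, and a representation of \<open>G\<close> is a subspace \<open>V\<close> of \<open>'v\<close> together with
  an action \<open>act\<close> of \<open>carrier G\<close> on \<open>V\<close>.  A function on \<open>V\<close> is represented by any function on
  \<open>'v\<close>; only its values on \<open>V\<close> are ever used.
\<close>

definition dual_on :: "('k::field \<Rightarrow> 'v::ab_group_add \<Rightarrow> 'v) \<Rightarrow> 'v set \<Rightarrow> ('v \<Rightarrow> 'k) set" where
  "dual_on scale V =
     {l. (\<forall>u\<in>V. \<forall>w\<in>V. l (u + w) = l u + l w) \<and> (\<forall>c. \<forall>u\<in>V. l (scale c u) = c * l u)}"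

definition fun_scale :: "'k::field \<Rightarrow> ('x \<Rightarrow> 'k) \<Rightarrow> 'x \<Rightarrow> 'k" where
  "fun_scale c f = (\<lambda>x. c * f x)"

text \<open>The image of \<open>S\<^sup>d(V\<^sup>*)\<close> in the functions on \<open>V\<close>: linear combinations of products of \<open>d\<close>
  linear forms.\<close>

definition homog_poly_funs ::
    "('k::field \<Rightarrow> 'v::ab_group_add \<Rightarrow> 'v) \<Rightarrow> 'v set \<Rightarrow> nat \<Rightarrow> ('v \<Rightarrow> 'k) set" where
  "homog_poly_funs scale V d =
     module.span fun_scale {(\<lambda>v. \<Prod>i<d. l i v) | l. \<forall>i<d. l i \<in> dual_on scale V}"

definition fun_act ::
    "('g, 'm) monoid_scheme \<Rightarrow> ('g \<Rightarrow> 'v \<Rightarrow> 'v) \<Rightarrow> 'g \<Rightarrow> ('v \<Rightarrow> 'k) \<Rightarrow> 'v \<Rightarrow> 'k" where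
  "fun_act G act g f = (\<lambda>v. f (act (inv\<^bsub>G\<^esub> g) v))"

definition homog_invariants ::
    "('k::field \<Rightarrow> 'v::ab_group_add \<Rightarrow> 'v) \<Rightarrow> 'v set \<Rightarrow> ('g, 'm) monoid_scheme \<Rightarrow> ('g \<Rightarrow> 'v \<Rightarrow> 'v)
      \<Rightarrow> nat \<Rightarrow> ('v \<Rightarrow> 'k) set" where
  "homog_invariants scale V G act d =
     {f \<in> homog_poly_funs scale V d. \<forall>g\<in>carrier G. \<forall>v\<in>V. fun_act G act g f v = f v}"

text \<open>The infimum is taken in \<open>enat\<close>, where \<open>Inf {} = \<infinity>\<close>.\<close>

definition epsilon ::
    "('k::field \<Rightarrow> 'v::ab_group_add \<Rightarrow> 'v) \<Rightarrow> 'v set \<Rightarrow> ('g, 'm) monoid_scheme \<Rightarrow> ('g \<Rightarrow> 'v \<Rightarrow> 'v)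
      \<Rightarrow> 'v \<Rightarrow> enat" where
  "epsilon scale V G act v =
     Inf {enat d | d. d > 0 \<and> (\<exists>f\<in>homog_invariants scale V G act d. f v \<noteq> 0)}"

definition fixed_vectors ::
    "'v set \<Rightarrow> ('g, 'm) monoid_scheme \<Rightarrow> ('g \<Rightarrow> 'v \<Rightarrow> 'v) \<Rightarrow> 'v set" where
  "fixed_vectors V G act = {v \<in> V. \<forall>g\<in>carrier G. act g v = v}"

text \<open>An element \<open>\<Sum>\<^sub>h a\<^sub>h h\<close> of the group algebra is its coefficient function, extended by \<open>0\<close>
  outside \<open>carrier G\<close>; the coefficient of \<open>g \<cdot> \<Sum>\<^sub>h a\<^sub>h h = \<Sum>\<^sub>h a\<^sub>h gh\<close> at \<open>h\<close> is that of the
  original element at \<open>g\<^sup>-\<^sup>1h\<close>.\<close>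

definition reg_space :: "('g, 'm) monoid_scheme \<Rightarrow> ('g \<Rightarrow> 'k::field) set" where
  "reg_space G = {a. \<forall>h. h \<notin> carrier G \<longrightarrow> a h = 0}"

definition reg_act :: "('g, 'm) monoid_scheme \<Rightarrow> 'g \<Rightarrow> ('g \<Rightarrow> 'k::field) \<Rightarrow> 'g \<Rightarrow> 'k" where
  "reg_act G g a = (\<lambda>h. if h \<in> carrier G then a (inv\<^bsub>G\<^esub> g \<otimes>\<^bsub>G\<^esub> h) else 0)"

text \<open>\<open>V\<^sup>n\<close> as the families \<open>v 0, \<dots>, v (n - 1)\<close> in \<open>V\<close>, extended by \<open>0\<close>.\<close>

definition pow_space :: "nat \<Rightarrow> 'v::ab_group_add set \<Rightarrow> (nat \<Rightarrow> 'v) set" where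
  "pow_space n V = {v. (\<forall>i<n. v i \<in> V) \<and> (\<forall>i\<ge>n. v i = 0)}"

definition pow_scale :: "('k \<Rightarrow> 'v \<Rightarrow> 'v) \<Rightarrow> 'k \<Rightarrow> (nat \<Rightarrow> 'v) \<Rightarrow> nat \<Rightarrow> 'v" where
  "pow_scale scale c v = (\<lambda>i. scale c (v i))"

definition pow_act :: "('g \<Rightarrow> 'v \<Rightarrow> 'v) \<Rightarrow> 'g \<Rightarrow> (nat \<Rightarrow> 'v) \<Rightarrow> nat \<Rightarrow> 'v" where
  "pow_act act g v = (\<lambda>i. act g (v i))"

definition sylow_subgroup :: "nat \<Rightarrow> 'g set \<Rightarrow> ('g, 'm) monoid_scheme \<Rightarrow> bool" where
  "sylow_subgroup p P G \<longleftrightarrow> subgroup P G \<and> card P = p ^ multiplicity p (Coset.order G)"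

lemma vector_space_fun_scale: "vector_space (fun_scale :: 'k::field \<Rightarrow> ('x \<Rightarrow> 'k) \<Rightarrow> 'x \<Rightarrow> 'k)"
  by unfold_locales (auto simp: fun_scale_def fun_eq_iff algebra_simps)

lemma vector_space_pow_scale:
  assumes "vector_space scale"
  shows "vector_space (pow_scale scale)"
proof -
  interpret vector_space scale by fact
  show ?thesis
    by unfold_locales
       (auto simp: pow_scale_def fun_eq_iff scale_right_distrib scale_left_distrib)
qed

lemma pow_reg_act_closed:
  assumes "group G" "g \<in> carrier G" "v \<in> pow_space n (reg_space G)"
  shows "pow_act (reg_act G) g v \<in> pow_space n (reg_space G)"
  using assms by (auto simp: pow_act_def reg_act_def pow_space_def reg_space_def fun_eq_iff)

lemma pow_reg_act_one:
  assumes "group G" "v \<in> pow_space n (reg_space G)"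
  shows "pow_act (reg_act G) \<one>\<^bsub>G\<^esub> v = v"
proof -
  interpret group G by fact
  have "v i h = 0" if "h \<notin> carrier G" for i h
    using assms(2) that
    by (cases "i < n") (auto simp: pow_space_def reg_space_def)
  then show ?thesis
    by (auto simp: pow_act_def reg_act_def fun_eq_iff)
qed

lemma pow_reg_act_mult:
  assumes "group G" "g \<in> carrier G" "g' \<in> carrier G"
  shows "pow_act (reg_act G) (g \<otimes>\<^bsub>G\<^esub> g') v = pow_act (reg_act G) g (pow_act (reg_act G) g' v)"
proof -
  interpret group G by fact
  show ?thesis
    using assms(2,3) by (auto simp: pow_act_def reg_act_def fun_eq_iff inv_mult_group m_assoc)
qed

end

theory Submission
  imports Defs
begin

text \<open>
  Coordinates of \<open>V\<close> are indexed by \<open>I = {0,\<dots>,n-1} \<times> G\<close>, which \<open>G\<close> permutes freely, so monomials of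
  degree \<open>d\<close> are multisets of size \<open>d\<close> on \<open>I\<close>.  Let \<open>f = \<Sum>\<^sub>M c\<^sub>M x\<^sup>M\<close> be an invariant and \<open>v\<close> a fixed
  vector.  The numbers \<open>c\<^sub>M v\<^sup>M\<close> are constant on \<open>P\<close>-orbits of multisets, and orbits that are not
  fixed points have size divisible by \<open>p\<close>; hence \<open>f(v) \<noteq> 0\<close> forces a \<open>P\<close>-fixed multiset of size \<open>d\<close>.
  Since \<open>P\<close> acts freely on \<open>I\<close>, such a multiset has size divisible by \<open>|P|\<close>.  Conversely, if
  \<open>v\<^sub>i \<noteq> 0\<close>, then the sum over the left cosets \<open>C\<close> of \<open>P\<close> of the monomials \<open>\<Prod>\<^sub>h\<^sub>\<in>\<^sub>C x\<^sub>i\<^sub>h\<close> is an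
  invariant of degree \<open>|P|\<close> whose value at \<open>v\<close> is \<open>[G : P]\<close> times a nonzero power.
\<close>

section \<open>Infinitude of the ground field\<close>

text \<open>Euclid's argument: over a finite field the product of all \<open>[:- a, 1:]\<close>,
  plus 1, would have positive degree but take the value 1 everywhere. Infinitude later turns
  equality of polynomial functions in \<open>t\<close> into equality of coefficients.\<close>

lemma infinite_UNIV_alg_closed_field: "infinite (UNIV :: 'k::alg_closed_field set)"
proof
  assume fin: "finite (UNIV :: 'k set)"
  define q :: "'k poly" where "q = (\<Prod>a\<in>UNIV. [:- a, 1:])"
  have "degree q = (\<Sum>a\<in>(UNIV::'k set). degree [:- a, 1:])"
    unfolding q_def by (rule degree_prod_sum_eq) auto
  also have "\<dots> = card (UNIV :: 'k set)"
    by simp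
  finally have "degree q > 0"
    using fin by (simp add: finite_UNIV_card_ge_0)
  then have "degree (q + 1) > 0"
    by (simp add: degree_add_eq_left)
  then obtain x where "poly (q + 1) x = 0"
    using alg_closed_imp_poly_has_root by blast
  moreover have "poly q x = 0"
    using fin by (auto simp: q_def poly_prod prod_zero_iff)
  ultimately show False
    by simp
qed

section \<open>Group actions on finite sets and on multisets\<close>

text \<open>Bijectivity comes from the action of the inverse element. The \<open>restrict\<close> is
  there because elements of \<open>BijGroup E\<close> are extensional functions.\<close>

lemma group_action_restrictI:
  assumes "group H"
    and closed: "\<And>g x. g \<in> carrier H \<Longrightarrow> x \<in> E \<Longrightarrow> \<phi> g x \<in> E"
    and one: "\<And>x. x \<in> E \<Longrightarrow> \<phi> \<one>\<^bsub>H\<^esub> x = x"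
    and mult: "\<And>g h x. g \<in> carrier H \<Longrightarrow> h \<in> carrier H \<Longrightarrow> x \<in> E \<Longrightarrow> \<phi> (g \<otimes>\<^bsub>H\<^esub> h) x = \<phi> g (\<phi> h x)"
  shows "group_action H E (\<lambda>g. restrict (\<phi> g) E)"
proof -
  interpret group H by fact
  have bij: "restrict (\<phi> g) E \<in> Bij E" if g: "g \<in> carrier H" for g
  proof -
    have "bij_betw (\<phi> g) E E"
    proof (rule bij_betwI[where g = "\<phi> (inv\<^bsub>H\<^esub> g)"])
      show "\<phi> (inv\<^bsub>H\<^esub> g) (\<phi> g x) = x" if "x \<in> E" for x
        using mult[of "inv\<^bsub>H\<^esub> g" g x] g that one by simp
      show "\<phi> g (\<phi> (inv\<^bsub>H\<^esub> g) x) = x" if "x \<in> E" for x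
        using mult[of g "inv\<^bsub>H\<^esub> g" x] g that one by simp
    qed (use closed g in auto)
    then show ?thesis
      by (simp add: Bij_def cong: bij_betw_cong)
  qed
  show ?thesis
    unfolding group_action_def
  proof (intro group_hom.intro group_hom_axioms.intro homI)
    show "group (BijGroup E)"
      by (rule group_BijGroup)
    show "restrict (\<phi> g) E \<in> carrier (BijGroup E)" if "g \<in> carrier H" for g
      using bij[OF that] by (simp add: BijGroup_def)
    show "restrict (\<phi> (g \<otimes>\<^bsub>H\<^esub> h)) E
        = restrict (\<phi> g) E \<otimes>\<^bsub>BijGroup E\<^esub> restrict (\<phi> h) E"
      if "g \<in> carrier H" "h \<in> carrier H" for g h
      using that bij closed mult by (auto simp: BijGroup_def compose_def restrict_def)
  qed fact
qed

text \<open>With \<open>E\<close> as index set of the variables, this is the induced permutation of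
  the monomials of degree \<open>d\<close>.\<close>

lemma (in group_action) group_action_multisets:
  "group_action G (multisets_of_size E d) (\<lambda>g. restrict (image_mset (\<phi> g)) (multisets_of_size E d))"
proof (rule group_action_restrictI)
  show "group G"
    using group_hom by (rule group_hom.axioms)
  show "image_mset (\<phi> g) M \<in> multisets_of_size E d"
    if "g \<in> carrier G" "M \<in> multisets_of_size E d" for g M
    using that element_image by (auto simp: multisets_of_size_def)
  show "image_mset (\<phi> \<one>) M = M" if "M \<in> multisets_of_size E d" for M
  proof -
    have "image_mset (\<phi> \<one>) M = image_mset (\<lambda>x. x) M"
      using that by (intro image_mset_cong) (auto simp: multisets_of_size_def simp flip: id_eq_one)
    then show ?thesis
      by simp
  qed
  show "image_mset (\<phi> (g \<otimes> h)) M = image_mset (\<phi> g) (image_mset (\<phi> h) M)"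
    if "g \<in> carrier G" "h \<in> carrier G" "M \<in> multisets_of_size E d" for g h M
    using that by (auto simp: multisets_of_size_def image_mset.compositionality o_def
        composition_rule intro!: image_mset_cong)
qed

text \<open>Orbit sizes divide \<open>p ^ a\<close>, and without fixed points none of them is 1. So
  on each orbit a constant value is added up a multiple of \<open>p\<close> times.\<close>

lemma (in group_action) sum_invariant_eq_0_if_no_fixed_points:
  fixes b :: "_ \<Rightarrow> 'k::idom"
  assumes "finite E" and "Factorial_Ring.prime p" and "of_nat p = (0::'k)" and "Coset.order G = p ^ a"
    and inv: "\<And>g x. g \<in> carrier G \<Longrightarrow> x \<in> E \<Longrightarrow> b (\<phi> g x) = b x"
    and nofix: "\<And>x. x \<in> E \<Longrightarrow> \<exists>g\<in>carrier G. \<phi> g x \<noteq> x"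
  shows "(\<Sum>x\<in>E. b x) = 0"
proof -
  have "(\<Sum>y\<in>orb. b y) = 0" if orb: "orb \<in> orbits G E \<phi>" for orb
  proof -
    obtain x where x: "x \<in> E" "orb = orbit G \<phi> x"
      using orb by (auto simp: orbits_def)
    have "card orb dvd p ^ a"
      using orbit_stabilizer_theorem[OF x(1)] assms(4) x(2) by (metis dvd_triv_left)
    then obtain e where e: "card orb = p ^ e"
      using \<open>Factorial_Ring.prime p\<close> divides_primepow_nat by blast
    have "card orb \<noteq> 1"
    proof
      assume "card orb = 1"
      moreover have "x \<in> orb"
        using x orbit_refl by blast
      ultimately have "orb = {x}"
        by (metis card_1_singletonE singletonD)
      then show False
        using nofix[OF x(1)] x(2) by (auto simp: orbit_def)
    qed
    with e have "p dvd card orb"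
      by (cases e) auto
    then have "of_nat (card orb) = (0::'k)"
      using assms(3) by (auto elim!: dvdE)
    moreover have "(\<Sum>y\<in>orb. b y) = (\<Sum>y\<in>orb. b x)"
      by (intro sum.cong) (use x inv in \<open>auto simp: orbit_def\<close>)
    ultimately show ?thesis
      by simp
  qed
  then show ?thesis
    using disjoint_sum[OF \<open>finite E\<close>, of b] by simp
qed

text \<open>Multiplicities in a fixed multiset are constant on orbits, and freeness gives every
  orbit exactly \<open>Coset.order G\<close> elements.\<close>

lemma (in group_action) order_dvd_size_if_free:
  assumes "finite E" and "set_mset M \<subseteq> E"
    and free: "\<And>g x. g \<in> carrier G \<Longrightarrow> x \<in> E \<Longrightarrow> \<phi> g x = x \<Longrightarrow> g = \<one>"
    and fix_M: "\<And>g. g \<in> carrier G \<Longrightarrow> image_mset (\<phi> g) M = M"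
  shows "Coset.order G dvd size M"
proof -
  have inv: "count M (\<phi> g x) = count M x" if "g \<in> carrier G" "x \<in> E" for g x
  proof -
    have "count M (\<phi> g x) = count (image_mset (\<phi> g) M) (\<phi> g x)"
      using fix_M that by simp
    also have "\<dots> = (\<Sum>y | y \<in># M \<and> \<phi> g x = \<phi> g y. count M y)"
      by (simp add: count_image_mset')
    also have "{y. y \<in># M \<and> \<phi> g x = \<phi> g y} = (if x \<in># M then {x} else {})"
      using inj_prop[OF that(1)] that assms(2) by (auto simp: inj_on_def)
    finally show ?thesis
      by (auto simp: not_in_iff split: if_splits)
  qed
  have "Coset.order G dvd (\<Sum>y\<in>orb. count M y)" if orb: "orb \<in> orbits G E \<phi>" for orb
  proof -
    obtain x where x: "x \<in> E" "orb = orbit G \<phi> x"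
      using orb by (auto simp: orbits_def)
    have "stabilizer G \<phi> x = {\<one>}"
      using free x(1) stabilizer_one_closed[OF x(1)] by (auto simp: stabilizer_def)
    then have "card orb = Coset.order G"
      using orbit_stabilizer_theorem[OF x(1)] x(2) by simp
    moreover have "(\<Sum>y\<in>orb. count M y) = (\<Sum>y\<in>orb. count M x)"
      by (intro sum.cong) (use x inv in \<open>auto simp: orbit_def\<close>)
    ultimately show ?thesis
      by simp
  qed
  then have "Coset.order G dvd (\<Sum>x\<in>E. count M x)"
    using disjoint_sum[OF \<open>finite E\<close>, of "count M"] by (metis dvd_sum)
  also have "(\<Sum>x\<in>E. count M x) = size M"
    unfolding size_multiset_overloaded_eq
    using assms(1,2) by (intro sum.mono_neutral_right) (auto simp: not_in_iff)
  finally show ?thesis .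
qed

section \<open>Separating monomials by weights and comparing coefficients\<close>

text \<open>Weights as in Kronecker substitution: the powers of \<open>d + 1\<close>.\<close>

lemma inj_weights_exist:
  assumes "finite I"
  shows "\<exists>w::'i \<Rightarrow> nat. inj_on (\<lambda>M. \<Sum>i\<in>#M. w i) {M. set_mset M \<subseteq> I \<and> size M \<le> d}"
  using assms
proof (induction I)
  case empty
  then show ?case
    by (auto simp: inj_on_def)
next
  case (insert a I)
  then obtain w :: "'i \<Rightarrow> nat"
    where w: "inj_on (\<lambda>M. \<Sum>i\<in>#M. w i) {M. set_mset M \<subseteq> I \<and> size M \<le> d}"
    by blast
  \<comment> \<open>In base \<open>Suc d\<close> the multiplicity of \<open>a\<close> becomes the
    lowest digit of the new weight, and the old weight moves up by one digit.\<close>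
  define w' where "w' i = (if i = a then 1 else Suc d * w i)" for i
  let ?rest = "filter_mset (\<lambda>i. i \<noteq> a)"
  have split: "M = replicate_mset (count M a) a + ?rest M" for M
    by (rule multiset_eqI) auto
  have weight: "(\<Sum>i\<in>#M. w' i) = count M a + Suc d * (\<Sum>i\<in>#?rest M. w i)" for M
  proof -
    have "image_mset w' (?rest M) = image_mset (\<lambda>i. Suc d * w i) (?rest M)"
      by (rule image_mset_cong) (simp add: w'_def)
    then have "(\<Sum>i\<in>#?rest M. w' i) = Suc d * (\<Sum>i\<in>#?rest M. w i)"
      by (simp only: sum_mset_distrib_left)
    moreover have "(\<Sum>i\<in>#M. w' i)
        = (\<Sum>i\<in>#replicate_mset (count M a) a + ?rest M. w' i)"
      by (simp only: split[symmetric])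
    ultimately show ?thesis
      by (simp add: w'_def)
  qed
  have "inj_on (\<lambda>M. \<Sum>i\<in>#M. w' i) {M. set_mset M \<subseteq> insert a I \<and> size M \<le> d}"
  proof (rule inj_onI, clarify)
    fix M N
    assume M: "set_mset M \<subseteq> insert a I" "size M \<le> d"
      and N: "set_mset N \<subseteq> insert a I" "size N \<le> d"
      and eq: "(\<Sum>i\<in>#M. w' i) = (\<Sum>i\<in>#N. w' i)"
    have small: "count M a < Suc d" "count N a < Suc d"
      using M N count_le_size[of M a] count_le_size[of N a] by auto
    have "count M a = (\<Sum>i\<in>#M. w' i) mod Suc d" "count N a = (\<Sum>i\<in>#N. w' i) mod Suc d"
      unfolding weight using small by (simp_all only: mod_mult_self2 mod_less)
    with eq have count: "count M a = count N a"
      by simp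
    with eq have "Suc d * (\<Sum>i\<in>#?rest M. w i) = Suc d * (\<Sum>i\<in>#?rest N. w i)"
      unfolding weight by (simp only: add_left_cancel)
    then have "(\<Sum>i\<in>#?rest M. w i) = (\<Sum>i\<in>#?rest N. w i)"
      by (simp only: mult_cancel1) simp
    \<comment> \<open>Dropping the copies of \<open>a\<close> may lower the size, which is why the
      induction runs over size at most \<open>d\<close> instead of exactly \<open>d\<close>.\<close>
    then have "?rest M = ?rest N"
      using M N by (intro inj_onD[OF w]) (auto intro: order_trans[OF size_filter_mset_lesseq])
    with count have "replicate_mset (count M a) a + ?rest M = replicate_mset (count N a) a + ?rest N"
      by (simp only:)
    then show "M = N"
      by (simp only: split[symmetric])
  qed
  then show ?case
    by blast
qed

text \<open>Comparing coefficients of \<open>t\<close> along the curve \<open>t \<mapsto> (v\<^sub>j t\<^bsup>w j\<^esup>)\<^sub>j\<close>.\<close>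

lemma monomial_values_invariant:
  fixes c :: "'i multiset \<Rightarrow> 'k::alg_closed_field" and v :: "'i \<Rightarrow> 'k"
  assumes "finite I" and "inj_on \<sigma> I" and "\<sigma> ` I \<subseteq> I"
    and inv: "\<And>x. (\<And>j. j \<notin> I \<Longrightarrow> x j = 0) \<Longrightarrow>
      (\<Sum>M\<in>multisets_of_size I d. c M * (\<Prod>j\<in>#M. x (\<sigma> j)))
        = (\<Sum>M\<in>multisets_of_size I d. c M * (\<Prod>j\<in>#M. x j))"
    and v: "\<And>j. j \<in> I \<Longrightarrow> v (\<sigma> j) = v j"
    and N: "N \<in> multisets_of_size I d"
  shows "c (image_mset \<sigma> N) * (\<Prod>j\<in>#image_mset \<sigma> N. v j) = c N * (\<Prod>j\<in>#N. v j)"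
proof -
  let ?X = "multisets_of_size I d"
  obtain w :: "'i \<Rightarrow> nat"
    where w: "inj_on (\<lambda>M. \<Sum>i\<in>#M. w i) {M. set_mset M \<subseteq> I \<and> size M \<le> d}"
    using inj_weights_exist[OF \<open>finite I\<close>] by blast
  define W where "W M = (\<Sum>i\<in>#M. w i)" for M
  define b where "b M = c M * (\<Prod>j\<in>#M. v j)" for M
  have W: "inj_on W ?X"
    unfolding W_def by (rule inj_on_subset[OF w]) (auto simp: multisets_of_size_def)
  have \<sigma>_closed: "image_mset \<sigma> M \<in> ?X" if "M \<in> ?X" for M
    using that assms(3) by (auto simp: multisets_of_size_def)
  have \<sigma>_inj: "M = M'" if "M \<in> ?X" "M' \<in> ?X" "image_mset \<sigma> M = image_mset \<sigma> M'" for M M'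
  proof -
    have "image_mset (inv_into I \<sigma>) (image_mset \<sigma> K) = K" if "K \<in> ?X" for K
    proof -
      have "image_mset (inv_into I \<sigma> \<circ> \<sigma>) K = image_mset (\<lambda>x. x) K"
        using that assms(2) by (intro image_mset_cong) (auto simp: multisets_of_size_def)
      then show ?thesis
        by (simp add: image_mset.compositionality)
    qed
    then show ?thesis
      using that by metis
  qed
  have mono_curve: "(\<Prod>j\<in>#M. v j * t ^ w j) = (\<Prod>j\<in>#M. v j) * t ^ W M" for M t
    by (induction M) (auto simp: W_def power_add)
  have fin: "finite ?X"
    using \<open>finite I\<close> by blast
  \<comment> \<open>These are the two sides of \<open>inv\<close> along the curve: \<open>p1\<close>
    for \<open>x\<close> itself, \<open>p2\<close> for \<open>x\<close> composed with
    \<open>\<sigma>\<close>. Since \<open>v\<close> is \<open>\<sigma>\<close>-invariant on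
    \<open>I\<close>, the coefficient in \<open>p2\<close> is still \<open>b M\<close>; only the
    exponent is shifted by \<open>\<sigma>\<close>.\<close>
  define p1 where "p1 = (\<Sum>M\<in>?X. monom (b M) (W M))"
  define p2 where "p2 = (\<Sum>M\<in>?X. monom (b M) (W (image_mset \<sigma> M)))"
  have "poly p1 t = poly p2 t" for t
  proof -
    \<comment> \<open>The curve is cut off to 0 outside \<open>I\<close>, since \<open>inv\<close>
      speaks only of points supported on \<open>I\<close>.\<close>
    define x where "x j = (if j \<in> I then v j * t ^ w j else 0)" for j
    have x_M: "(\<Prod>j\<in>#M. x j) = (\<Prod>j\<in>#M. v j) * t ^ W M" if "M \<in> ?X" for M
    proof -
      have "(\<Prod>j\<in>#M. x j) = (\<Prod>j\<in>#M. v j * t ^ w j)"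
        using that by (intro arg_cong[where f = prod_mset] image_mset_cong)
          (auto simp: x_def multisets_of_size_def)
      then show ?thesis
        by (simp add: mono_curve)
    qed
    have x_\<sigma>M: "(\<Prod>j\<in>#M. x (\<sigma> j)) = (\<Prod>j\<in>#M. v j) * t ^ W (image_mset \<sigma> M)" if "M \<in> ?X" for M
    proof -
      have "(\<Prod>j\<in>#M. x (\<sigma> j)) = (\<Prod>j\<in>#image_mset \<sigma> M. x j)"
        by (simp add: image_mset.compositionality o_def)
      also have "\<dots> = (\<Prod>j\<in>#image_mset \<sigma> M. v j) * t ^ W (image_mset \<sigma> M)"
        by (rule x_M[OF \<sigma>_closed[OF that]])
      also have "(\<Prod>j\<in>#image_mset \<sigma> M. v j) = (\<Prod>j\<in>#M. v j)"
        unfolding image_mset.compositionality o_def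
        using that v by (intro arg_cong[where f = prod_mset] image_mset_cong)
          (auto simp: multisets_of_size_def)
      finally show ?thesis .
    qed
    have "poly p1 t = (\<Sum>M\<in>?X. c M * (\<Prod>j\<in>#M. x j))"
      by (simp add: p1_def poly_sum poly_monom b_def x_M mult.assoc)
    also have "\<dots> = (\<Sum>M\<in>?X. c M * (\<Prod>j\<in>#M. x (\<sigma> j)))"
      by (rule inv[symmetric]) (simp add: x_def)
    also have "\<dots> = poly p2 t"
      by (simp add: p2_def poly_sum poly_monom b_def x_\<sigma>M mult.assoc)
    finally show ?thesis .
  qed
  then have "{t. poly (p1 - p2) t = 0} = UNIV"
    by auto
  then have "p1 = p2"
    using poly_roots_finite[of "p1 - p2"] infinite_UNIV_alg_closed_field[where 'k = 'k] by auto
  \<comment> \<open>Distinct multisets have distinct weights, so this coefficient isolates the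
    single term \<open>image_mset \<sigma> N\<close> in \<open>p1\<close> and,
    \<open>\<sigma>\<close> being injective on multisets, the single term \<open>N\<close> in
    \<open>p2\<close>.\<close>
  have "coeff p1 (W (image_mset \<sigma> N)) = (\<Sum>M\<in>?X. if M = image_mset \<sigma> N then b M else 0)"
    using inj_onD[OF W] \<sigma>_closed[OF N] by (auto simp: p1_def coeff_sum intro!: sum.cong)
  moreover have "coeff p2 (W (image_mset \<sigma> N)) = (\<Sum>M\<in>?X. if M = N then b M else 0)"
    using inj_onD[OF W] \<sigma>_closed \<sigma>_inj N by (auto simp: p2_def coeff_sum intro!: sum.cong)
  ultimately have "b (image_mset \<sigma> N) = b N"
    using \<open>p1 = p2\<close> fin N \<sigma>_closed[OF N] by simp
  then show ?thesis
    by (simp add: b_def)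
qed

section \<open>Divisibility of the degree for free actions of p-groups\<close>

text \<open>Abstract form of the lower bound: here \<open>G\<close> is the p-group itself, and the
  polynomial is given by a coefficient family \<open>c\<close>. A sum that is nonzero in
  characteristic \<open>p\<close> forces a fixed multiset, and freeness restricts its size.\<close>

lemma (in group_action) order_dvd_degree_if_free:
  fixes c :: "_ multiset \<Rightarrow> 'k::alg_closed_field" and v :: "_ \<Rightarrow> 'k"
  assumes "finite E" and "Factorial_Ring.prime p" and "of_nat p = (0::'k)" and "Coset.order G = p ^ a"
    and free: "\<And>g x. g \<in> carrier G \<Longrightarrow> x \<in> E \<Longrightarrow> \<phi> g x = x \<Longrightarrow> g = \<one>"
    and inv: "\<And>g x. g \<in> carrier G \<Longrightarrow> (\<And>j. j \<notin> E \<Longrightarrow> x j = 0) \<Longrightarrow>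
      (\<Sum>M\<in>multisets_of_size E d. c M * (\<Prod>j\<in>#M. x (\<phi> g j)))
        = (\<Sum>M\<in>multisets_of_size E d. c M * (\<Prod>j\<in>#M. x j))"
    and v: "\<And>g j. g \<in> carrier G \<Longrightarrow> j \<in> E \<Longrightarrow> v (\<phi> g j) = v j"
    and nz: "(\<Sum>M\<in>multisets_of_size E d. c M * (\<Prod>j\<in>#M. v j)) \<noteq> 0"
  shows "Coset.order G dvd d"
proof -
  let ?X = "multisets_of_size E d"
  let ?\<psi> = "\<lambda>g. restrict (image_mset (\<phi> g)) ?X"
  interpret X: group_action G ?X ?\<psi>
    by (rule group_action_multisets)
  have "\<exists>M\<in>?X. \<forall>g\<in>carrier G. ?\<psi> g M = M"
  proof (rule ccontr)
    assume nofix: "\<not> ?thesis"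
    have "(\<Sum>M\<in>?X. c M * (\<Prod>j\<in>#M. v j)) = 0"
    proof (rule X.sum_invariant_eq_0_if_no_fixed_points)
      show "finite ?X"
        using \<open>finite E\<close> by blast
      show "c (?\<psi> g M) * (\<Prod>j\<in>#?\<psi> g M. v j) = c M * (\<Prod>j\<in>#M. v j)"
        if g: "g \<in> carrier G" and M: "M \<in> ?X" for g M
      proof -
        have "c (image_mset (\<phi> g) M) * (\<Prod>j\<in>#image_mset (\<phi> g) M. v j) = c M * (\<Prod>j\<in>#M. v j)"
          using inv[OF g] v[OF g] surj_prop[OF g] M
          by (intro monomial_values_invariant[OF \<open>finite E\<close> inj_prop[OF g]]) auto
        then show ?thesis
          using M by simp
      qed
    qed (use assms nofix in auto)
    with nz show False
      by simp
  qed
  then obtain M where "M \<in> ?X" and "\<And>g. g \<in> carrier G \<Longrightarrow> image_mset (\<phi> g) M = M"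
    by auto
  then show ?thesis
    using order_dvd_size_if_free[OF \<open>finite E\<close> _ free, of M] by (auto simp: multisets_of_size_def)
qed

section \<open>Polynomial functions in coordinates\<close>

text \<open>The order of quantifiers matters: one family \<open>c\<close> serves all points
  \<open>x\<close>. The induction multiplies by one more form and regroups the resulting terms by
  monomial.\<close>

lemma prod_linear_forms_eq_sum_monomials:
  fixes a :: "nat \<Rightarrow> 'i \<Rightarrow> 'k::comm_ring_1"
  assumes "finite I"
  shows "\<exists>c. \<forall>x. (\<Prod>k<d. \<Sum>j\<in>I. a k j * x j)
    = (\<Sum>M\<in>multisets_of_size I d. c M * (\<Prod>j\<in>#M. x j))"
proof (induction d)
  case 0
  show ?case
    by (rule exI[of _ "\<lambda>_. 1"]) simp
next
  case (Suc d)
  let ?X = "multisets_of_size I"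
  let ?add = "\<lambda>(M, j). add_mset j M"
  obtain c where c: "(\<Prod>k<d. \<Sum>j\<in>I. a k j * x j) = (\<Sum>M\<in>?X d. c M * (\<Prod>j\<in>#M. x j))" for x
    using Suc by blast
  \<comment> \<open>A monomial \<open>N\<close> of degree \<open>Suc d\<close> arises once for each
    distinct \<open>j\<close> in it, as \<open>x j\<close> times the monomial of the rest.\<close>
  define c' where "c' N = (\<Sum>(M, j) | (M, j) \<in> ?X d \<times> I \<and> add_mset j M = N. c M * a d j)" for N
  have fin: "finite (?X e)" for e
    using assms by blast
  have "(\<Prod>k<Suc d. \<Sum>j\<in>I. a k j * x j) = (\<Sum>N\<in>?X (Suc d). c' N * (\<Prod>j\<in>#N. x j))" for x
  proof -
    let ?h = "\<lambda>(M, j). c M * a d j * (\<Prod>j\<in>#add_mset j M. x j)"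
    have "(\<Prod>k<Suc d. \<Sum>j\<in>I. a k j * x j)
        = (\<Sum>M\<in>?X d. c M * (\<Prod>j\<in>#M. x j)) * (\<Sum>j\<in>I. a d j * x j)"
      by (simp add: c)
    also have "\<dots> = (\<Sum>q\<in>?X d \<times> I. ?h q)"
      unfolding sum_product sum.cartesian_product by (intro sum.cong) (auto simp: mult_ac)
    also have "\<dots> = (\<Sum>N\<in>?X (Suc d). \<Sum>q | q \<in> ?X d \<times> I \<and> ?add q = N. ?h q)"
      by (rule sum.group[symmetric]) (use fin assms in \<open>auto simp: multisets_of_size_def\<close>)
    also have "\<dots> = (\<Sum>N\<in>?X (Suc d). c' N * (\<Prod>j\<in>#N. x j))"
      unfolding c'_def sum_distrib_right by (intro sum.cong) auto
    finally show ?thesis .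
  qed
  then show ?case
    by blast
qed

text \<open>A form in \<open>dual_on\<close> is linear on \<open>V\<close> only, so the basis
  expansion is built up inside \<open>V\<close>, adding one coordinate at a time.\<close>

lemma pow_reg_dual_coordinates:
  fixes l :: "(nat \<Rightarrow> 'g \<Rightarrow> 'k::field) \<Rightarrow> 'k"
  assumes "finite (carrier G)"
    and "l \<in> dual_on (pow_scale fun_scale) (pow_space n (reg_space G))"
  shows "\<exists>a. \<forall>x\<in>pow_space n (reg_space G).
    l x = (\<Sum>j\<in>{..<n} \<times> carrier G. a j * case_prod x j)"
proof -
  let ?V = "pow_space n (reg_space G) :: (nat \<Rightarrow> 'g \<Rightarrow> 'k) set"
  let ?I = "{..<n} \<times> carrier G"
  have l_add: "l (u + w) = l u + l w" if "u \<in> ?V" "w \<in> ?V" for u w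
    using assms(2) that by (auto simp: dual_on_def)
  have l_scale: "l (pow_scale fun_scale b u) = b * l u" if "u \<in> ?V" for b u
    using assms(2) that by (auto simp: dual_on_def)
  \<comment> \<open>\<open>e j\<close> is the standard basis vector at \<open>j\<close>, and
    \<open>trunc J\<close> is the projection onto the coordinates in \<open>J\<close>.\<close>
  define e :: "nat \<times> 'g \<Rightarrow> nat \<Rightarrow> 'g \<Rightarrow> 'k" where "e j = (\<lambda>i h. if (i, h) = j then 1 else 0)" for j
  define trunc where "trunc J x = (\<lambda>i h. if (i, h) \<in> J then x i h else 0)"
    for J and x :: "nat \<Rightarrow> 'g \<Rightarrow> 'k"
  have e_V: "e j \<in> ?V" if "j \<in> ?I" for j
    using that by (auto simp: e_def pow_space_def reg_space_def fun_eq_iff)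
  have scale_V: "pow_scale fun_scale b u \<in> ?V" if "u \<in> ?V" for b u
    using that by (auto simp: pow_scale_def fun_scale_def pow_space_def reg_space_def fun_eq_iff)
  have trunc_V: "trunc J x \<in> ?V" if "J \<subseteq> ?I" for J x
    using that by (auto simp: trunc_def pow_space_def reg_space_def fun_eq_iff)
  have "l (trunc J x) = (\<Sum>j\<in>J. l (e j) * case_prod x j)" if "finite J" "J \<subseteq> ?I" for J x
    using that
  proof (induction J)
    case empty
    \<comment> \<open>\<open>trunc {} x\<close> is the zero vector, and \<open>l\<close> vanishes
      there by homogeneity with scalar 0.\<close>
    have "trunc {} x = pow_scale fun_scale 0 (trunc {} x)"
      by (auto simp: trunc_def pow_scale_def fun_scale_def)
    then have "l (trunc {} x) = 0 * l (trunc {} x)"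
      using l_scale[OF trunc_V[of "{}"]] by (metis empty_subsetI)
    then show ?case
      by simp
  next
    case (insert j J)
    have "trunc (insert j J) x = pow_scale fun_scale (case_prod x j) (e j) + trunc J x"
      using insert.hyps by (auto simp: trunc_def e_def pow_scale_def fun_scale_def fun_eq_iff)
    then have "l (trunc (insert j J) x) = case_prod x j * l (e j) + l (trunc J x)"
      using insert.prems by (simp add: l_add l_scale e_V scale_V trunc_V)
    then show ?case
      using insert by (simp add: mult.commute)
  qed
  from this[of ?I] have "l (trunc ?I x) = (\<Sum>j\<in>?I. l (e j) * case_prod x j)" for x
    using assms(1) by simp
  moreover have "trunc ?I x = x" if "x \<in> ?V" for x
    using that unfolding trunc_def pow_space_def reg_space_def fun_eq_iff
    by (auto simp: fun_eq_iff) (metis not_less)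
  ultimately have "\<forall>x\<in>?V. l x = (\<Sum>j\<in>?I. l (e j) * case_prod x j)"
    by metis
  then show ?thesis
    by (rule exI[of _ "\<lambda>j. l (e j)"])
qed

lemma pow_reg_homog_poly_fun_coordinates:
  fixes f :: "(nat \<Rightarrow> 'g \<Rightarrow> 'k::field) \<Rightarrow> 'k"
  assumes "finite (carrier G)"
    and "f \<in> homog_poly_funs (pow_scale fun_scale) (pow_space n (reg_space G)) d"
  shows "\<exists>c. \<forall>x\<in>pow_space n (reg_space G).
    f x = (\<Sum>M\<in>multisets_of_size ({..<n} \<times> carrier G) d. c M * (\<Prod>j\<in>#M. case_prod x j))"
proof -
  let ?V = "pow_space n (reg_space G) :: (nat \<Rightarrow> 'g \<Rightarrow> 'k) set"
  let ?I = "{..<n} \<times> carrier G"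
  interpret vector_space "fun_scale :: 'k \<Rightarrow> ((nat \<Rightarrow> 'g \<Rightarrow> 'k) \<Rightarrow> 'k) \<Rightarrow> _"
    by (rule vector_space_fun_scale)
  show ?thesis
    using assms(2) unfolding homog_poly_funs_def
  proof (induction rule: span_induct_alt)
    case base
    show ?case
      by (rule exI[of _ "\<lambda>_. 0"]) simp
  next
    case (step b x y)
    obtain l where x: "x = (\<lambda>u. \<Prod>k<d. l k u)"
      and l: "\<forall>k<d. l k \<in> dual_on (pow_scale fun_scale) ?V"
      using step.hyps by blast
    have "\<forall>k. \<exists>a. k < d \<longrightarrow> (\<forall>u\<in>?V. l k u = (\<Sum>j\<in>?I. a j * case_prod u j))"
      using pow_reg_dual_coordinates[OF assms(1)] l by blast
    then obtain a where a: "l k u = (\<Sum>j\<in>?I. a k j * case_prod u j)" if "k < d" "u \<in> ?V" for k u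
      by metis
    obtain c1 where c1: "(\<Prod>k<d. \<Sum>j\<in>?I. a k j * u j)
        = (\<Sum>M\<in>multisets_of_size ?I d. c1 M * (\<Prod>j\<in>#M. u j))" for u
      using prod_linear_forms_eq_sum_monomials[of ?I a d] assms(1) by auto
    obtain c2 where c2: "\<forall>u\<in>?V. y u = (\<Sum>M\<in>multisets_of_size ?I d. c2 M * (\<Prod>j\<in>#M. case_prod u j))"
      using step.IH by blast
    have "x u = (\<Sum>M\<in>multisets_of_size ?I d. c1 M * (\<Prod>j\<in>#M. case_prod u j))" if "u \<in> ?V" for u
      using a that by (simp add: x flip: c1)
    with c2 show ?case
      by (intro exI[of _ "\<lambda>M. b * c1 M + c2 M"])
        (simp add: fun_scale_def distrib_right sum.distrib sum_distrib_left mult.assoc)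
  qed
qed

section \<open>The lower bound for the regular representation\<close>

text \<open>\<open>fun_act\<close> evaluates at the translate by the inverse of \<open>g\<close>,
  and \<open>reg_act\<close> inverts once more, so coordinates are translated by \<open>g\<close>
  itself.\<close>

lemma reg_act_inv_apply:
  assumes "group G" and "g \<in> carrier G" and "h \<in> carrier G"
  shows "pow_act (reg_act G) (inv\<^bsub>G\<^esub> g) x i h = x i (g \<otimes>\<^bsub>G\<^esub> h)"
  using assms by (simp add: pow_act_def reg_act_def group.inv_inv)

lemma pow_reg_fixed_vector_translate:
  assumes "group G" and "g \<in> carrier G" and "h \<in> carrier G"
    and "v \<in> fixed_vectors (pow_space n (reg_space G)) G (pow_act (reg_act G))"
  shows "v i (g \<otimes>\<^bsub>G\<^esub> h) = v i h"
proof -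
  have "pow_act (reg_act G) (inv\<^bsub>G\<^esub> g) v = v"
    using assms by (auto simp: fixed_vectors_def group.inv_closed)
  then show ?thesis
    using reg_act_inv_apply[OF assms(1-3), of v i] by simp
qed

text \<open>By cancellation, left multiplication by \<open>P\<close> on
  \<open>{..<n} \<times> carrier G\<close> is free, so the abstract bound applies to
  \<open>G\<lparr>carrier := P\<rparr>\<close>.\<close>

lemma p_subgroup_order_dvd_invariant_degree:
  fixes v :: "nat \<Rightarrow> 'g \<Rightarrow> 'k::alg_closed_field"
  assumes "group G" and "finite (carrier G)" and "subgroup P G"
    and "Factorial_Ring.prime p" and "of_nat p = (0::'k)" and "card P = p ^ a"
    and v: "v \<in> fixed_vectors (pow_space n (reg_space G)) G (pow_act (reg_act G))"
    and f: "f \<in> homog_invariants (pow_scale fun_scale) (pow_space n (reg_space G)) G (pow_act (reg_act G)) d"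
    and "f v \<noteq> 0"
  shows "card P dvd d"
proof -
  interpret group G by fact
  interpret P: subgroup P G by fact
  let ?V = "pow_space n (reg_space G) :: (nat \<Rightarrow> 'g \<Rightarrow> 'k) set"
  let ?I = "{..<n} \<times> carrier G"
  let ?H = "G\<lparr>carrier := P\<rparr>"
  define \<phi> where "\<phi> g = restrict (\<lambda>(i, h). (i, g \<otimes>\<^bsub>G\<^esub> h)) ?I" for g
  have "group_action ?H ?I \<phi>"
    unfolding \<phi>_def
    by (rule group_action_restrictI)
      (auto simp: m_assoc intro: subgroup_imp_group[OF \<open>subgroup P G\<close>])
  then interpret H: group_action ?H ?I \<phi> .
  obtain c where c: "f x = (\<Sum>M\<in>multisets_of_size ?I d. c M * (\<Prod>j\<in>#M. case_prod x j))"
    if "x \<in> ?V" for x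
    using pow_reg_homog_poly_fun_coordinates[OF assms(2), of f n d] f
    by (auto simp: homog_invariants_def)
  have order: "Coset.order ?H = card P"
    by (simp add: Coset.order_def)
  have "v \<in> ?V"
    using v by (simp add: fixed_vectors_def)
  have "Coset.order ?H dvd d"
  proof (rule H.order_dvd_degree_if_free[where v = "case_prod v" and c = c])
    show "g = \<one>\<^bsub>?H\<^esub>" if "g \<in> carrier ?H" "j \<in> ?I" "\<phi> g j = j" for g j
      using that by (auto simp: \<phi>_def r_cancel_one')
    show "(\<Sum>M\<in>multisets_of_size ?I d. c M * (\<Prod>j\<in>#M. x (\<phi> g j)))
        = (\<Sum>M\<in>multisets_of_size ?I d. c M * (\<Prod>j\<in>#M. x j))"
      if g: "g \<in> carrier ?H" and x: "\<And>j. j \<notin> ?I \<Longrightarrow> x j = 0" for g and x :: "nat \<times> 'g \<Rightarrow> 'k"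
    proof -
      \<comment> \<open>The coordinate family \<open>x\<close> becomes the vector \<open>y\<close>,
        and \<open>z\<close> is the point at which \<open>fun_act\<close> evaluates
        \<open>f\<close>; on the index set its coordinates are \<open>x\<close> composed with
        \<open>\<phi> g\<close>.\<close>
      define y where "y = curry x"
      define z where "z = pow_act (reg_act G) (inv\<^bsub>G\<^esub> g) y"
      have g': "g \<in> carrier G"
        using g by auto
      have y: "y \<in> ?V"
        using x by (auto simp: y_def pow_space_def reg_space_def fun_eq_iff)
      then have z: "z \<in> ?V"
        unfolding z_def using g' by (intro pow_reg_act_closed) auto
      have z_j: "case_prod z j = x (\<phi> g j)" if "j \<in> ?I" for j
        using that g' by (auto simp: z_def y_def reg_act_inv_apply[OF \<open>group G\<close>] \<phi>_def)
      have "f z = f y"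
        using f g' y by (auto simp: homog_invariants_def fun_act_def z_def)
      moreover have "f z = (\<Sum>M\<in>multisets_of_size ?I d. c M * (\<Prod>j\<in>#M. x (\<phi> g j)))"
        unfolding c[OF z]
        by (intro sum.cong arg_cong2[where f = "(*)"] arg_cong[where f = prod_mset] image_mset_cong z_j)
          (auto simp: multisets_of_size_def)
      moreover have "f y = (\<Sum>M\<in>multisets_of_size ?I d. c M * (\<Prod>j\<in>#M. x j))"
        unfolding c[OF y] by (simp add: y_def)
      ultimately show ?thesis
        by simp
    qed
    show "case_prod v (\<phi> g j) = case_prod v j" if "g \<in> carrier ?H" "j \<in> ?I" for g j
      using that pow_reg_fixed_vector_translate[OF \<open>group G\<close> _ _ v] by (auto simp: \<phi>_def)
    show "(\<Sum>M\<in>multisets_of_size ?I d. c M * (\<Prod>j\<in>#M. case_prod v j)) \<noteq> 0"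
      using c[OF \<open>v \<in> ?V\<close>] \<open>f v \<noteq> 0\<close> by simp
  qed (use assms order in auto)
  then show ?thesis
    by (simp add: order)
qed

section \<open>An invariant of degree \<open>card P\<close>, and the value of epsilon\<close>

text \<open>Left multiplication by \<open>G\<close> permutes the left cosets of \<open>P\<close> and
  hence the summands, each of which is a product of \<open>card P\<close> coordinate
  functions.\<close>

lemma sum_lcosets_monomials_invariant:
  fixes G :: "('g, 'm) monoid_scheme"
  assumes "group G" and "finite (carrier G)" and "subgroup P G" and "i < n"
  shows "(\<lambda>x :: nat \<Rightarrow> 'g \<Rightarrow> 'k::field. \<Sum>C\<in>lcosets\<^bsub>G\<^esub> P. \<Prod>h\<in>C. x i h)
    \<in> homog_invariants (pow_scale fun_scale) (pow_space n (reg_space G)) G (pow_act (reg_act G)) (card P)"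
    (is "?F \<in> _")
proof -
  interpret group G by fact
  interpret P: subgroup P G by fact
  let ?V = "pow_space n (reg_space G) :: (nat \<Rightarrow> 'g \<Rightarrow> 'k) set"
  interpret vs: vector_space "fun_scale :: 'k \<Rightarrow> ((nat \<Rightarrow> 'g \<Rightarrow> 'k) \<Rightarrow> 'k) \<Rightarrow> _"
    by (rule vector_space_fun_scale)
  have C_sub: "C \<subseteq> carrier G" if "C \<in> lcosets\<^bsub>G\<^esub> P" for C
    using that P.subset by (auto simp: LCOSETS_def l_coset_def)
  have "(\<lambda>x. \<Prod>h\<in>C. x i h) \<in> homog_poly_funs (pow_scale fun_scale) ?V (card P)"
    if "C \<in> lcosets\<^bsub>G\<^esub> P" for C
  proof -
    have "card C = card P"
      using l_card_cosets_equal[OF that P.subset \<open>finite (carrier G)\<close>] by simp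
    moreover have "finite C"
      using C_sub[OF that] \<open>finite (carrier G)\<close> by (rule finite_subset)
    \<comment> \<open>\<open>homog_poly_funs\<close> indexes the factors of a product by numbers
      below the degree, so the coset is enumerated.\<close>
    ultimately obtain b where b: "bij_betw b {..<card P} C"
      using ex_bij_betw_nat_finite by (metis atLeast0LessThan)
    have "(\<lambda>x. \<Prod>h\<in>C. x i h) = (\<lambda>x :: nat \<Rightarrow> 'g \<Rightarrow> 'k. \<Prod>k<card P. x i (b k))"
      by (rule ext) (rule prod.reindex_bij_betw[OF b, symmetric])
    moreover have "(\<lambda>x. x i (b k)) \<in> dual_on (pow_scale fun_scale) ?V" for k
      by (auto simp: dual_on_def pow_scale_def fun_scale_def)
    ultimately show ?thesis
      unfolding homog_poly_funs_def by (intro vs.span_base) auto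
  qed
  then have "(\<Sum>C\<in>lcosets\<^bsub>G\<^esub> P. (\<lambda>x. \<Prod>h\<in>C. x i h)) \<in> homog_poly_funs (pow_scale fun_scale) ?V (card P)"
    unfolding homog_poly_funs_def by (rule vs.span_sum)
  moreover have "(\<Sum>C\<in>S. (\<lambda>x. \<Prod>h\<in>C. x i h)) = (\<lambda>x :: nat \<Rightarrow> 'g \<Rightarrow> 'k. \<Sum>C\<in>S. \<Prod>h\<in>C. x i h)" for S
    by (induction S rule: infinite_finite_induct) (auto simp: fun_eq_iff)
  ultimately have "?F \<in> homog_poly_funs (pow_scale fun_scale) ?V (card P)"
    by simp
  moreover have "?F (pow_act (reg_act G) (inv\<^bsub>G\<^esub> g) x) = ?F x" if g: "g \<in> carrier G" for g x
  proof -
    have translate: "k <#\<^bsub>G\<^esub> C \<in> lcosets\<^bsub>G\<^esub> P" if "C \<in> lcosets\<^bsub>G\<^esub> P" "k \<in> carrier G" for k C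
      using that by (auto simp: LCOSETS_def lcos_m_assoc P.subset)
    have cancel: "k <#\<^bsub>G\<^esub> (k' <#\<^bsub>G\<^esub> C) = C"
      if "C \<in> lcosets\<^bsub>G\<^esub> P" "k \<in> carrier G" "k' \<in> carrier G" "k \<otimes>\<^bsub>G\<^esub> k' = \<one>\<^bsub>G\<^esub>" for k k' C
      using that C_sub by (simp add: lcos_m_assoc lcos_mult_one)
    show ?thesis
    proof (rule sum.reindex_bij_witness[where i = "\<lambda>C. inv\<^bsub>G\<^esub> g <#\<^bsub>G\<^esub> C" and j = "\<lambda>C. g <#\<^bsub>G\<^esub> C"])
      fix C assume C: "C \<in> lcosets\<^bsub>G\<^esub> P"
      have "bij_betw ((\<otimes>\<^bsub>G\<^esub>) g) C (g <#\<^bsub>G\<^esub> C)"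
        using g C_sub[OF C] by (auto simp: bij_betw_def inj_on_def l_coset_def subset_iff)
      then have "(\<Prod>h\<in>g <#\<^bsub>G\<^esub> C. x i h) = (\<Prod>h\<in>C. x i (g \<otimes>\<^bsub>G\<^esub> h))"
        by (rule prod.reindex_bij_betw[symmetric])
      also have "\<dots> = (\<Prod>h\<in>C. pow_act (reg_act G) (inv\<^bsub>G\<^esub> g) x i h)"
        using g C_sub[OF C] by (intro prod.cong) (auto simp: reg_act_inv_apply[OF \<open>group G\<close>])
      finally show "(\<Prod>h\<in>g <#\<^bsub>G\<^esub> C. x i h) = (\<Prod>h\<in>C. pow_act (reg_act G) (inv\<^bsub>G\<^esub> g) x i h)" .
    qed (use g translate cancel in auto)
  qed
  ultimately show ?thesis
    by (simp add: homog_invariants_def fun_act_def)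
qed

theorem lemma3p2:
  fixes G :: "('g, 'm) monoid_scheme"
    and P :: "'g set"
    and p n :: nat
    and v :: "nat \<Rightarrow> 'g \<Rightarrow> 'k::alg_closed_field"
  assumes "CHAR('k) = p" and "p > 0"
    and "group G" and "finite (carrier G)"
    and "sylow_subgroup p P G"
    and "v \<in> fixed_vectors (pow_space n (reg_space G)) G (pow_act (reg_act G)) - {0}"
  shows "epsilon (pow_scale fun_scale) (pow_space n (reg_space G)) G (pow_act (reg_act G)) v
           = enat (card P)"
proof -
  interpret group G by fact
  have sub: "subgroup P G" and card_P: "card P = p ^ multiplicity p (Coset.order G)"
    using assms(5) by (auto simp: sylow_subgroup_def)
  interpret P: subgroup P G by fact
  have prime: "Factorial_Ring.prime p"
    using prime_CHAR_semidom[where 'a = 'k] assms(1,2) by simp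
  have p_0: "of_nat p = (0::'k)"
    using assms(1) by (simp add: of_nat_eq_0_iff_char_dvd)
  have v: "v \<in> fixed_vectors (pow_space n (reg_space G)) G (pow_act (reg_act G))" and "v \<noteq> 0"
    using assms(6) by auto
  have card_P_pos: "card P > 0"
    using card_P \<open>p > 0\<close> by simp

  have v_V: "v \<in> pow_space n (reg_space G)"
    using v by (simp add: fixed_vectors_def)
  obtain i h where nz: "v i h \<noteq> 0"
    using \<open>v \<noteq> 0\<close> by (auto simp: fun_eq_iff)
  have "i < n"
    using nz v_V by (cases "i < n") (auto simp: pow_space_def)
  have h: "h \<in> carrier G"
    using nz v_V \<open>i < n\<close> by (auto simp: pow_space_def reg_space_def)
  \<comment> \<open>Left translation is transitive on \<open>carrier G\<close>: the component
    \<open>v i\<close> is a scalar multiple of the norm element, the sum of all group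
    elements.\<close>
  have v_const: "v i h' = v i h" if "h' \<in> carrier G" for h'
    using pow_reg_fixed_vector_translate[OF \<open>group G\<close> _ h v, of "h' \<otimes>\<^bsub>G\<^esub> inv\<^bsub>G\<^esub> h" i] that h
    by (simp add: m_assoc)
  define F :: "(nat \<Rightarrow> 'g \<Rightarrow> 'k) \<Rightarrow> 'k" where "F x = (\<Sum>C\<in>lcosets\<^bsub>G\<^esub> P. \<Prod>h\<in>C. x i h)" for x
  have F: "F \<in> homog_invariants (pow_scale fun_scale) (pow_space n (reg_space G)) G
      (pow_act (reg_act G)) (card P)"
    unfolding F_def using sum_lcosets_monomials_invariant[OF assms(3,4) sub \<open>i < n\<close>] .
  have "F v = (\<Sum>C\<in>lcosets\<^bsub>G\<^esub> P. v i h ^ card P)"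
    unfolding F_def
  proof (rule sum.cong[OF refl])
    fix C assume C: "C \<in> lcosets\<^bsub>G\<^esub> P"
    have "(\<Prod>h'\<in>C. v i h') = (\<Prod>h'\<in>C. v i h)"
      using C P.subset by (intro prod.cong v_const) (auto simp: LCOSETS_def l_coset_def)
    also have "\<dots> = v i h ^ card P"
      using l_card_cosets_equal[OF C P.subset assms(4)] by simp
    finally show "(\<Prod>h'\<in>C. v i h') = v i h ^ card P" .
  qed
  then have F_v: "F v = of_nat (card (lcosets\<^bsub>G\<^esub> P)) * v i h ^ card P"
    by simp
  \<comment> \<open>This is where \<open>P\<close> has to be a full Sylow subgroup: a factor
    \<open>p\<close> in the index would exceed the multiplicity of \<open>p\<close> in the group
    order. Hence the index is nonzero in the field.\<close>
  have "\<not> p dvd card (lcosets\<^bsub>G\<^esub> P)"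
  proof
    assume "p dvd card (lcosets\<^bsub>G\<^esub> P)"
    then have "p * p ^ multiplicity p (Coset.order G) dvd Coset.order G"
      using l_lagrange[OF assms(4) sub] card_P by (metis mult_dvd_mono dvd_refl)
    moreover have "Coset.order G \<noteq> 0"
      using assms(4) by (simp add: order_gt_0_iff_finite)
    ultimately show False
      using prime by (metis Suc_n_not_le_n not_prime_unit multiplicity_geI power_Suc)
  qed
  then have "F v \<noteq> 0"
    using nz assms(1) by (simp add: F_v of_nat_eq_0_iff_char_dvd)

  show ?thesis
    unfolding epsilon_def
  proof (rule antisym)
    show "Inf {enat d | d. d > 0 \<and> (\<exists>f\<in>homog_invariants (pow_scale fun_scale)
        (pow_space n (reg_space G)) G (pow_act (reg_act G)) d. f v \<noteq> 0)} \<le> enat (card P)"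
      using F \<open>F v \<noteq> 0\<close> card_P_pos by (intro Inf_lower) blast
    show "enat (card P) \<le> Inf {enat d | d. d > 0 \<and> (\<exists>f\<in>homog_invariants (pow_scale fun_scale)
        (pow_space n (reg_space G)) G (pow_act (reg_act G)) d. f v \<noteq> 0)}"
    proof (rule Inf_greatest, clarsimp)
      fix d f
      assume "d > 0" "f v \<noteq> 0" and "f \<in> homog_invariants (pow_scale fun_scale)
        (pow_space n (reg_space G)) G (pow_act (reg_act G)) d"
      \<comment> \<open>Positivity of \<open>d\<close> turns divisibility by \<open>card P\<close>
        into the inequality.\<close>
      then show "card P \<le> d"
        using p_subgroup_order_dvd_invariant_degree[OF assms(3,4) sub prime p_0 card_P v]
        by (intro dvd_imp_le)
    qed
  qed
qed

end
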